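(* Let $G$ be a locally compact group with a compact generating set $K\ni 1$, and let $X$ be a complete Busemann non-positively curved uniformly convex metric space. Suppose that $G$ acts continuously by isometries on $X$ and that $d_K(x)\to\infty$ when $x\to\infty$, where $d_K(x)=\max_{k\in K}d(x,k\cdot x)$. Let $m=\inf_{x\in X}d_K(x)$. Then the set $$M=\{x\in X: d_K(x)=m\}$$ of points with minimal $K$-displacement is non-empty, closed, convex and bounded.
   Context: $X$ is a (non-empty) geodesic metric space with metric $d$. It is strictly convex if every pair $y,z\in X$ has a midpoint $m_{y,z}$ (a point with $d(y,m_{y,z})=d(z,m_{y,z})=\tfrac12 d(y,z)$) and $d(x,m_{y,z})<\max\{d(x,y),d(x,z)\}$ for all $x$ and all $y\neq z$ (so midpoints and geodesic segments between points are unique). It is uniformly convex if it is strictly convex and for every $\epsilon>0$ there is $\delta(\epsilon)>0$ such that for all $r>0$ and $x,y,z\in X$ with $d(x,y)\le r$, $d(x,z)\le r$ and $d(y,z)\geq \epsilon r$ one has $d(x,m_{y,z})\le (1-\delta(\epsilon))r$. It is Busemann non-positively curved (BNPC) if $d(m_{x,y},m_{x,z})\le\tfrac12 d(y,z)$ for all $x,y,z\in X$. Examples are CAT(0) spaces and uniformly convex Banach spaces. A subset of $X$ is convex if it contains the geodesic segment between any two of its points. "$x\to\infty$" means that $x$ eventually leaves every ball in $X$; thus "$d_K(x)\to\infty$ when $x\to\infty$" means that for every $R$ the set $\{x\in X: d_K(x)\le R\}$ is bounded. The action is continuous if the map $G\times X\to X$ is continuous. *)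

theory Defs
  imports "HOL-Analysis.Analysis" "HOL-Algebra.Group_Action" "HOL-Algebra.Generated_Groups"
begin

context Metric_space
begin

definition geodesic_path :: "(real \<Rightarrow> 'a) \<Rightarrow> 'a \<Rightarrow> 'a \<Rightarrow> bool" where
  "geodesic_path \<gamma> y z \<longleftrightarrow>
     \<gamma> ` {0..d y z} \<subseteq> M \<and> \<gamma> 0 = y \<and> \<gamma> (d y z) = z \<and>
     (\<forall>s\<in>{0..d y z}. \<forall>t\<in>{0..d y z}. d (\<gamma> s) (\<gamma> t) = \<bar>s - t\<bar>)"

definition geodesic_space :: bool where
  "geodesic_space \<longleftrightarrow> M \<noteq> {} \<and> (\<forall>y\<in>M. \<forall>z\<in>M. \<exists>\<gamma>. geodesic_path \<gamma> y z)"

text \<open>In a strictly convex space there is only one geodesic segment between two points, so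
  it makes no difference that all of them are required to lie in the set.\<close>

definition geodesically_convex :: "'a set \<Rightarrow> bool" where
  "geodesically_convex C \<longleftrightarrow> C \<subseteq> M \<and>
     (\<forall>y\<in>C. \<forall>z\<in>C. \<forall>\<gamma>. geodesic_path \<gamma> y z \<longrightarrow> \<gamma> ` {0..d y z} \<subseteq> C)"

definition is_midpoint :: "'a \<Rightarrow> 'a \<Rightarrow> 'a \<Rightarrow> bool" where
  "is_midpoint y z m \<longleftrightarrow> m \<in> M \<and> d y m = d y z / 2 \<and> d z m = d y z / 2"

definition strictly_convex :: bool where
  "strictly_convex \<longleftrightarrow>
     (\<forall>y\<in>M. \<forall>z\<in>M. \<exists>m. is_midpoint y z m \<and>
        (y \<noteq> z \<longrightarrow> (\<forall>x\<in>M. d x m < max (d x y) (d x z))))"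

text \<open>Midpoints in a strictly convex space are unique, so quantifying over all midpoints
  \<open>m\<close> of \<open>y\<close> and \<open>z\<close>, as is done below, amounts to naming the one midpoint.\<close>

lemma midpoint_unique:
  assumes sc: strictly_convex and yz: "y \<in> M" "z \<in> M"
    and m: "is_midpoint y z m" and n: "is_midpoint y z n"
  shows "m = n"
proof (rule ccontr)
  assume "m \<noteq> n"
  have M: "m \<in> M" "n \<in> M"
    using m n by (auto simp: is_midpoint_def)
  then obtain p where p: "p \<in> M" and lt: "\<forall>x\<in>M. d x p < max (d x m) (d x n)"
    using sc \<open>m \<noteq> n\<close> unfolding strictly_convex_def is_midpoint_def by blast
  have "d y p < d y z / 2" "d z p < d y z / 2"
    using lt yz m n by (force simp: is_midpoint_def)+
  moreover have "d y z \<le> d y p + d z p"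
    using triangle[OF yz(1) p yz(2)] by (simp add: commute)
  ultimately show False
    by linarith
qed

definition uniformly_convex :: bool where
  "uniformly_convex \<longleftrightarrow> strictly_convex \<and>
     (\<forall>\<epsilon>>0. \<exists>\<delta>>0. \<forall>r>0. \<forall>x\<in>M. \<forall>y\<in>M. \<forall>z\<in>M. \<forall>m.
        is_midpoint y z m \<longrightarrow> d x y \<le> r \<longrightarrow> d x z \<le> r \<longrightarrow> d y z \<ge> \<epsilon> * r \<longrightarrow>
        d x m \<le> (1 - \<delta>) * r)"

definition busemann_nonpositively_curved :: bool where
  "busemann_nonpositively_curved \<longleftrightarrow>
     (\<forall>x\<in>M. \<forall>y\<in>M. \<forall>z\<in>M. \<forall>m n.
        is_midpoint x y m \<longrightarrow> is_midpoint x z n \<longrightarrow> d m n \<le> d y z / 2)"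

end

text \<open>No separation axiom is imposed; Hausdorff groups are a special case.\<close>

locale locally_compact_group = group G for G :: "('g, 'b) monoid_scheme" (structure) +
  fixes T :: "'g topology"
  assumes topspace_eq: "topspace T = carrier G"
    and continuous_mult: "continuous_map (prod_topology T T) T (\<lambda>(g, h). g \<otimes> h)"
    and continuous_inv: "continuous_map T T (\<lambda>g. inv g)"
    and locally_compact: "locally_compact_space T"

locale continuous_isometric_action =
  group: locally_compact_group G T + space: Metric_space X d + group_action G X \<phi>
  for G :: "('g, 'b) monoid_scheme" (structure) and T :: "'g topology"
    and X :: "'x set" and d :: "'x \<Rightarrow> 'x \<Rightarrow> real" and \<phi> :: "'g \<Rightarrow> 'x \<Rightarrow> 'x" +
  assumes isometric:
      "\<lbrakk>g \<in> carrier G; x \<in> X; y \<in> X\<rbrakk> \<Longrightarrow> d (\<phi> g x) (\<phi> g y) = d x y"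
    and continuous_action:
      "continuous_map (prod_topology T space.mtopology) space.mtopology (\<lambda>(g, x). \<phi> g x)"

definition displacement ::
  "('x \<Rightarrow> 'x \<Rightarrow> real) \<Rightarrow> ('g \<Rightarrow> 'x \<Rightarrow> 'x) \<Rightarrow> 'g set \<Rightarrow> 'x \<Rightarrow> real" where
  "displacement d \<phi> K x = (SUP k\<in>K. d x (\<phi> k x))"

text \<open>The supremum is a maximum for nonempty compact \<open>K\<close>.\<close>

lemma (in continuous_isometric_action) displacement_attained:
  assumes K: "compactin T K" "K \<noteq> {}" and x: "x \<in> X"
  shows "\<exists>k\<in>K. displacement d \<phi> K x = d x (\<phi> k x) \<and> (\<forall>l\<in>K. d x (\<phi> l x) \<le> d x (\<phi> k x))"
proof -
  have "continuous_map T (prod_topology T space.mtopology) (\<lambda>g. (g, x))"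
    using x by (intro continuous_map_pairedI) auto
  from continuous_map_compose[OF this continuous_action]
  have 1: "continuous_map T space.mtopology (\<lambda>g. \<phi> g x)"
    by (simp add: o_def)
  have "continuous_map T euclideanreal (\<lambda>g. d x (\<phi> g x))"
    using continuous_map_mdist[of T space.Self "\<lambda>_. x" "\<lambda>g. \<phi> g x"] 1 x
    by (simp add: mtopology_of_def)
  from image_compactin[OF K(1) this]
  have "compact ((\<lambda>g. d x (\<phi> g x)) ` K)"
    by simp
  then obtain k where k: "k \<in> K" "\<forall>l\<in>K. d x (\<phi> l x) \<le> d x (\<phi> k x)"
    using compact_attains_sup[of "(\<lambda>g. d x (\<phi> g x)) ` K"] K(2) by auto
  then have "displacement d \<phi> K x = d x (\<phi> k x)"
    unfolding displacement_def by (intro cSup_eq_maximum) auto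
  with k show ?thesis
    by blast
qed

end

theory Submission
  imports Defs
begin

text \<open>The displacement function is \<open>2\<close>-Lipschitz and, by the Busemann condition, midpoint-convex:
  \<open>k\<close> maps midpoints to midpoints, so the displacement of a midpoint can be estimated by going
  through the midpoint of \<open>x\<close> and \<open>k y\<close>. Its sublevel sets are therefore closed,
  convex and, by assumption, bounded. In a complete uniformly convex space a decreasing sequence of
  such nonempty sets has a common point: points of the sets that almost realise the distance to a
  fixed base point form a Cauchy sequence, since otherwise their midpoints would be too close to the
  base point. Applied to the sublevel sets \<open>m + 1/n\<close>, this yields a minimiser.\<close>

section \<open>Midpoints, geodesics and nested convex sets\<close>

context Metric_space
begin

text \<open>The Busemann and uniform convexity conditions speak of midpoints only, so convexity is
  first tested there; for closed sets this already gives geodesic convexity.\<close>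

definition midpoint_convex :: "'a set \<Rightarrow> bool" where
  "midpoint_convex C \<longleftrightarrow> (\<forall>y\<in>C. \<forall>z\<in>C. \<forall>p. is_midpoint y z p \<longrightarrow> p \<in> C)"

lemma is_midpoint_commute: "is_midpoint y z p \<longleftrightarrow> is_midpoint z y p"
  by (auto simp: is_midpoint_def commute)

lemma strictly_convex_midpoint_exists:
  assumes strictly_convex "y \<in> M" "z \<in> M"
  obtains p where "is_midpoint y z p"
  using assms unfolding strictly_convex_def by blast

lemma geodesic_path_midpoint:
  assumes \<gamma>: "geodesic_path \<gamma> y z" and ab: "0 \<le> a" "a \<le> b" "b \<le> d y z"
  shows "is_midpoint (\<gamma> a) (\<gamma> b) (\<gamma> ((a + b) / 2))"
proof -
  have dist: "d (\<gamma> s) (\<gamma> t) = \<bar>s - t\<bar>" if "s \<in> {0..d y z}" "t \<in> {0..d y z}" for s t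
    using \<gamma> that by (auto simp: geodesic_path_def)
  have "(a + b) / 2 \<in> {0..d y z}"
    using ab by (auto simp: field_simps)
  moreover have "\<gamma> ((a + b) / 2) \<in> M"
    using \<gamma> calculation by (auto simp: geodesic_path_def)
  ultimately show ?thesis
    using ab by (simp add: is_midpoint_def dist abs_if field_simps)
qed

text \<open>A geodesic path embeds the interval isometrically, so it is continuous on it.\<close>

lemma closedin_vimage_geodesic_path:
  assumes \<gamma>: "geodesic_path \<gamma> y z" and C: "closedin mtopology C"
  shows "closed {t \<in> {0..d y z}. \<gamma> t \<in> C}"
  unfolding closed_sequential_limits
proof (intro allI impI, elim conjE)
  fix s l
  assume s: "\<forall>n. s n \<in> {t \<in> {0..d y z}. \<gamma> t \<in> C}" and lim: "s \<longlonglongrightarrow> l"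
  have l: "l \<in> {0..d y z}"
    using closed_sequentially[OF closed_atLeastAtMost _ lim] s by blast
  have "limitin mtopology (\<gamma> \<circ> s) (\<gamma> l) sequentially"
  proof (subst limit_metric_sequentially, intro conjI allI impI)
    show "\<gamma> l \<in> M"
      using \<gamma> l by (auto simp: geodesic_path_def)
    fix e :: real assume "e > 0"
    then obtain N where "\<forall>n\<ge>N. \<bar>s n - l\<bar> < e"
      using lim by (auto simp: lim_sequentially dist_real_def)
    moreover have "(\<gamma> \<circ> s) n \<in> M \<and> d ((\<gamma> \<circ> s) n) (\<gamma> l) = \<bar>s n - l\<bar>" for n
      using \<gamma> s l by (auto simp: geodesic_path_def)
    ultimately show "\<exists>N. \<forall>n\<ge>N. (\<gamma> \<circ> s) n \<in> M \<and> d ((\<gamma> \<circ> s) n) (\<gamma> l) < e"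
      by auto
  qed
  then have "\<gamma> l \<in> C"
    using s by (intro limitin_closedin[OF _ C]) auto
  with l show "l \<in> {t \<in> {0..d y z}. \<gamma> t \<in> C}"
    by blast
qed

text \<open>The parameters with values in \<open>C\<close> form a closed set; a gap in it would have endpoints in
  it, hence also contain its own midpoint.\<close>

lemma geodesically_convex_if_midpoint_convex:
  assumes C: "closedin mtopology C" and mid: "midpoint_convex C"
  shows "geodesically_convex C"
  unfolding geodesically_convex_def
proof (intro conjI ballI allI impI subsetI)
  show "x \<in> M" if "x \<in> C" for x
    using closedin_subset[OF C] that by auto
  fix y z \<gamma> u
  assume yz: "y \<in> C" "z \<in> C" and \<gamma>: "geodesic_path \<gamma> y z" and "u \<in> \<gamma> ` {0..d y z}"
  then obtain t where t: "t \<in> {0..d y z}" "u = \<gamma> t"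
    by auto
  define S where "S = {t \<in> {0..d y z}. \<gamma> t \<in> C}"
  have S: "closed S" "S \<subseteq> {0..d y z}"
    using closedin_vimage_geodesic_path[OF \<gamma> C] by (auto simp: S_def)
  have "0 \<in> S" "d y z \<in> S"
    using \<gamma> yz t by (auto simp: S_def geodesic_path_def)
  \<comment> \<open>\<open>a\<close> and \<open>b\<close> will be the parameters in \<open>S\<close>
    nearest to \<open>t\<close> from below and from above; the aim is \<open>a = t\<close>.\<close>
  define A where "A = S \<inter> {..t}"
  define B where "B = S \<inter> {t..}"
  define a where "a = Sup A"
  define b where "b = Inf B"
  have bdd: "bdd_above A" "bdd_below B" and ne: "A \<noteq> {}" "B \<noteq> {}"
    using \<open>0 \<in> S\<close> \<open>d y z \<in> S\<close> t by (auto simp: A_def B_def)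
  moreover have "closed A" "closed B"
    using S(1) by (auto simp: A_def B_def intro: closed_Int)
  ultimately have a: "a \<in> A" and b: "b \<in> B"
    unfolding a_def b_def by (auto intro: closed_contains_Sup closed_contains_Inf)
  define c where "c = (a + b) / 2"
  have "is_midpoint (\<gamma> a) (\<gamma> b) (\<gamma> c)"
    unfolding c_def using a b S by (intro geodesic_path_midpoint[OF \<gamma>]) (auto simp: A_def B_def)
  then have "\<gamma> c \<in> C"
    using mid a b by (auto simp: midpoint_convex_def A_def B_def S_def)
  then have "c \<in> S"
    using a b by (auto simp: A_def B_def S_def c_def field_simps)
  then have "c \<in> A \<or> c \<in> B"
    by (auto simp: A_def B_def)
  then have "c \<le> a \<or> b \<le> c"
    using bdd by (auto simp: a_def b_def intro: cSup_upper cInf_lower)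
  then have "b \<le> a"
    by (auto simp: c_def)
  then have "a = t"
    using a b by (auto simp: A_def B_def)
  then show "u \<in> C"
    using a t by (auto simp: A_def S_def)
qed

text \<open>The midpoint \<open>r\<close> of the diagonal from \<open>x\<close> to \<open>y'\<close>
  belongs to a segment that shares \<open>x\<close> with the first one and \<open>y'\<close> with
  the second, so the Busemann condition bounds the distance from \<open>r\<close> to both
  \<open>p\<close> and \<open>q\<close>.\<close>

lemma busemann_midpoints_dist:
  assumes bnpc: busemann_nonpositively_curved and sc: strictly_convex
    and M: "x \<in> M" "y \<in> M" "x' \<in> M" "y' \<in> M"
    and p: "is_midpoint x y p" and q: "is_midpoint x' y' q"
  shows "2 * d p q \<le> d x x' + d y y'"
proof -
  obtain r where r: "is_midpoint x y' r"
    using strictly_convex_midpoint_exists[OF sc] M by blast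
  have "d p r \<le> d y y' / 2"
    using bnpc M p r unfolding busemann_nonpositively_curved_def by blast
  moreover have "d r q \<le> d x x' / 2"
    using bnpc M q r unfolding busemann_nonpositively_curved_def
    by (metis is_midpoint_commute)
  moreover have "d p q \<le> d p r + d r q"
    using p q r by (intro triangle) (auto simp: is_midpoint_def)
  ultimately show ?thesis
    by argo
qed

text \<open>The midpoint of two almost nearest points that are far apart would be closer to
  \<open>x\<close> than \<open>r\<close> allows. Since \<open>\<eta>\<close> depends only on
  \<open>e\<close> and \<open>R\<close>, it can be fixed before the set \<open>C\<close> is
  chosen.\<close>

lemma uniformly_convex_near_minimisers:
  assumes uc: uniformly_convex and "e > 0"
  obtains \<eta> where "\<eta> > 0"
    "\<And>C x y z s r. \<lbrakk>C \<subseteq> M; midpoint_convex C; x \<in> M; y \<in> C; z \<in> C;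
       \<And>w. w \<in> C \<Longrightarrow> r \<le> d x w; d x y \<le> s; d x z \<le> s; s \<le> R; s - r < \<eta>\<rbrakk> \<Longrightarrow> d y z < e"
proof -
  have sc: strictly_convex
    using uc by (simp add: uniformly_convex_def)
  \<comment> \<open>Uniform convexity measures separation relative to the radius \<open>s\<close>.
    As \<open>s \<le> R\<close>, a distance of at least \<open>e\<close> is at least this fraction
    of \<open>s\<close>; absolute value and \<open>+ 1\<close> keep the denominator
    positive.\<close>
  have pos: "e / (\<bar>R\<bar> + 1) > 0"
    using \<open>e > 0\<close> by simp
  obtain \<delta> where \<delta>: "\<delta> > 0" "\<And>s x y z p. \<lbrakk>s > 0; x \<in> M; y \<in> M; z \<in> M; is_midpoint y z p;
      d x y \<le> s; d x z \<le> s; d y z \<ge> e / (\<bar>R\<bar> + 1) * s\<rbrakk> \<Longrightarrow> d x p \<le> (1 - \<delta>) * s"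
    using uc[unfolded uniformly_convex_def, THEN conjunct2, rule_format, OF pos] by blast
  show thesis
  \<comment> \<open>Passing to the midpoint gains \<open>\<delta> * s\<close>, and two points within
    \<open>s\<close> of \<open>x\<close> at distance at least \<open>e\<close> force
    \<open>e / 2 \<le> s\<close>.\<close>
  proof (rule that[of "\<delta> * (e / 2)"])
    show "\<delta> * (e / 2) > 0"
      using \<delta> \<open>e > 0\<close> by simp
  next
    fix C x y z s r
    assume C: "C \<subseteq> M" "midpoint_convex C" and x: "x \<in> M" and yz: "y \<in> C" "z \<in> C"
      and r: "\<And>w. w \<in> C \<Longrightarrow> r \<le> d x w" and s: "d x y \<le> s" "d x z \<le> s" "s \<le> R"
      and less: "s - r < \<delta> * (e / 2)"
    have M: "y \<in> M" "z \<in> M"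
      using C yz by auto
    show "d y z < e"
    proof (rule ccontr)
      assume "\<not> d y z < e"
      moreover have "d y z \<le> d x y + d x z"
        using triangle[OF M(1) x M(2)] by (simp add: commute)
      ultimately have "e / 2 \<le> s"
        using s by linarith
      with \<open>e > 0\<close> have "s > 0"
        by linarith
      have "e / (\<bar>R\<bar> + 1) * s \<le> e / (\<bar>R\<bar> + 1) * (\<bar>R\<bar> + 1)"
        using pos s(3) by (intro mult_left_mono) auto
      then have "e / (\<bar>R\<bar> + 1) * s \<le> e"
        by simp
      with \<open>\<not> d y z < e\<close> have ge: "d y z \<ge> e / (\<bar>R\<bar> + 1) * s"
        by linarith
      obtain p where p: "is_midpoint y z p"
        using strictly_convex_midpoint_exists[OF sc M] .
      have "p \<in> C"
        using C(2) yz p unfolding midpoint_convex_def by blast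
      then have "r \<le> d x p"
        by (rule r)
      also have "\<dots> \<le> (1 - \<delta>) * s"
        using \<delta>(2)[OF \<open>s > 0\<close> x M p s(1,2) ge] .
      finally have "\<delta> * s \<le> s - r"
        by (simp add: algebra_simps)
      moreover have "\<delta> * (e / 2) \<le> \<delta> * s"
        using \<delta>(1) \<open>e / 2 \<le> s\<close> by (intro mult_left_mono) auto
      ultimately show False
        using less by linarith
    qed
  qed
qed

text \<open>This replaces compactness, which closed bounded sets need not have here.\<close>

proposition uniformly_convex_Inter_nonempty:
  assumes complete: mcomplete and uc: uniformly_convex
    and closed: "\<And>n. closedin mtopology (C n)" and mid: "\<And>n. midpoint_convex (C n)"
    and ne: "\<And>n. C n \<noteq> {}" and dec: "decseq C" and bounded: "mbounded (C (0::nat))"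
  shows "(\<Inter>n. C n) \<noteq> {}"
proof -
  have sub: "C n \<subseteq> M" for n
    using closedin_subset[OF closed[of n]] by simp
  obtain x where x0: "x \<in> C 0" and x: "x \<in> M"
    using ne[of 0] sub[of 0] by blast
  obtain B where B: "\<And>w. w \<in> C 0 \<Longrightarrow> d x w \<le> B"
    using bounded x0 by (auto simp: mbounded_alt)
  \<comment> \<open>The distance from \<open>x\<close> to \<open>C n\<close> grows as the sets
    shrink, and stays below \<open>B\<close> because every \<open>C n\<close> has a point, which
    lies in \<open>C 0\<close>.\<close>
  define r where "r n = (INF w\<in>C n. d x w)" for n
  have bdd: "bdd_below (d x ` C n)" for n
    by (rule bdd_belowI2[of _ 0]) simp
  have r_le: "r n \<le> d x w" if "w \<in> C n" for n w
    unfolding r_def using bdd that by (rule cINF_lower)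
  have "incseq r"
    unfolding r_def using dec bdd ne
    by (intro incseq_SucI cINF_superset_mono) (auto simp: decseq_Suc_iff)
  have "r n \<le> B" for n
    using ne[of n] dec r_le B by (metis decseqD equals0I le0 order_trans subsetD)
  then obtain l where l: "r \<longlonglongrightarrow> l" "\<And>n. r n \<le> l"
    using incseq_convergent[OF \<open>incseq r\<close>] by blast
  have "\<exists>w\<in>C n. d x w < r n + 1 / Suc n" for n
    unfolding r_def using cINF_less_iff[OF ne bdd]
    by (metis less_add_same_cancel1 of_nat_0_less_iff zero_less_Suc zero_less_divide_1_iff)
  then obtain y where y: "\<And>n. y n \<in> C n" "\<And>n. d x (y n) < r n + 1 / Suc n"
    by metis
  have y_tail: "y i \<in> C n" if "n \<le> i" for i n
    using y(1)[of i] decseqD[OF dec that] by blast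
  have "MCauchy y"
    unfolding MCauchy_def
  proof (intro conjI allI impI)
    show "range y \<subseteq> M"
      using y(1) sub by blast
    fix e :: real assume "e > 0"
    obtain \<eta> where \<eta>: "\<eta> > 0"
      "\<And>C x y z s r. \<lbrakk>C \<subseteq> M; midpoint_convex C; x \<in> M; y \<in> C; z \<in> C;
         \<And>w. w \<in> C \<Longrightarrow> r \<le> d x w; d x y \<le> s; d x z \<le> s; s \<le> l + 1; s - r < \<eta>\<rbrakk> \<Longrightarrow> d y z < e"
      by (fact uniformly_convex_near_minimisers[OF uc \<open>e > 0\<close>, of "l + 1"])
    \<comment> \<open>From index \<open>N\<close> on, all \<open>y i\<close> lie within the common
      radius \<open>l + 1 / Suc N\<close>, which is at most \<open>l + 1\<close>; its excess over
      \<open>r N\<close> tends to 0.\<close>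
    have "(\<lambda>n. l + 1 / Suc n - r n) \<longlonglongrightarrow> l + 0 - l"
      using l(1) LIMSEQ_inverse_real_of_nat by (intro tendsto_intros) (auto simp: inverse_eq_divide)
    then obtain N where N: "l + 1 / Suc N - r N < \<eta>"
      using \<eta>(1) by (fastforce dest!: order_tendstoD(2)[of _ _ _ \<eta>] simp: eventually_sequentially)
    have near: "d x (y i) \<le> l + 1 / Suc N" if "N \<le> i" for i
    proof -
      have "1 / Suc i \<le> 1 / Suc N"
        using that by (simp add: frac_le)
      then show ?thesis
        using y(2)[of i] l(2)[of i] by linarith
    qed
    \<comment> \<open>Both points lie in the single set \<open>C N\<close>, to which the estimate
      applies.\<close>
    have "d (y i) (y j) < e" if "N \<le> i" "N \<le> j" for i j
      using that N
      by (intro \<eta>(2)[OF sub[of N] mid x y_tail y_tail r_le near near]) auto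
    then show "\<exists>N. \<forall>i j. N \<le> i \<longrightarrow> N \<le> j \<longrightarrow> d (y i) (y j) < e"
      by blast
  qed
  then obtain p where p: "limitin mtopology y p sequentially"
    using complete unfolding mcomplete_def by blast
  have "p \<in> C n" for n
    using y_tail by (intro limitin_closedin[OF p closed]) (auto simp: eventually_sequentially)
  then show ?thesis
    by blast
qed

end

section \<open>Continuity and convexity of the displacement\<close>

context continuous_isometric_action
begin

lemma image_in_space: "\<lbrakk>g \<in> carrier G; x \<in> X\<rbrakk> \<Longrightarrow> \<phi> g x \<in> X"
  using element_image by blast

lemma image_midpoint:
  assumes "g \<in> carrier G" "x \<in> X" "y \<in> X" "space.is_midpoint x y p"
  shows "space.is_midpoint (\<phi> g x) (\<phi> g y) (\<phi> g p)"
  using assms by (auto simp: space.is_midpoint_def isometric image_in_space)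

context
  fixes K
  assumes K: "compactin T K" "K \<noteq> {}"
begin

lemma in_carrier: "k \<in> K \<Longrightarrow> k \<in> carrier G"
  using compactin_subset_topspace[OF K(1)] group.topspace_eq by auto

lemma displacement_ge:
  assumes "x \<in> X" "k \<in> K"
  shows "d x (\<phi> k x) \<le> displacement d \<phi> K x"
  using displacement_attained[OF K assms(1)] assms(2) by force

lemma displacement_leI:
  assumes "x \<in> X" "\<And>k. k \<in> K \<Longrightarrow> d x (\<phi> k x) \<le> r"
  shows "displacement d \<phi> K x \<le> r"
  using displacement_attained[OF K assms(1)] assms(2) by force

lemma displacement_nonneg:
  assumes "x \<in> X"
  shows "0 \<le> displacement d \<phi> K x"
  using displacement_attained[OF K assms] by auto

text \<open>The path from \<open>x\<close> to \<open>\<phi> k x\<close> through \<open>y\<close> and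
  \<open>\<phi> k y\<close> has two outer legs, of equal length because \<open>k\<close> acts
  isometrically.\<close>

lemma displacement_lipschitz:
  assumes x: "x \<in> X" and y: "y \<in> X"
  shows "displacement d \<phi> K x \<le> displacement d \<phi> K y + 2 * d x y"
proof (rule displacement_leI[OF x])
  fix k assume k: "k \<in> K"
  note kX = image_in_space[OF in_carrier[OF k]]
  have "d x (\<phi> k x) \<le> d x y + d y (\<phi> k x)"
    using x y kX by (intro space.triangle) auto
  also have "d y (\<phi> k x) \<le> d y (\<phi> k y) + d (\<phi> k y) (\<phi> k x)"
    using x y kX by (intro space.triangle) auto
  also have "d (\<phi> k y) (\<phi> k x) = d x y"
    using isometric[OF in_carrier[OF k] y x] by (simp add: space.commute)
  finally show "d x (\<phi> k x) \<le> displacement d \<phi> K y + 2 * d x y"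
    using displacement_ge[OF y k] by linarith
qed

lemma closedin_displacement_sublevel:
  "closedin space.mtopology {x \<in> X. displacement d \<phi> K x \<le> r}"
  unfolding space.closedin_metric
proof (intro conjI allI impI)
  fix x assume "x \<in> X - {x \<in> X. displacement d \<phi> K x \<le> r}"
  then have x: "x \<in> X" "displacement d \<phi> K x > r"
    by auto
  \<comment> \<open>Half the excess over \<open>r\<close> is the right radius because the Lipschitz
    constant is 2.\<close>
  have "disjnt {x \<in> X. displacement d \<phi> K x \<le> r}
      (space.mball x ((displacement d \<phi> K x - r) / 2))"
    using displacement_lipschitz[OF x(1)] by (fastforce simp: disjnt_iff)
  then show "\<exists>e>0. disjnt {x \<in> X. displacement d \<phi> K x \<le> r} (space.mball x e)"
    using x(2) by (intro exI[of _ "(displacement d \<phi> K x - r) / 2"]) auto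
qed auto

lemma midpoint_convex_displacement_sublevel:
  assumes bnpc: space.busemann_nonpositively_curved and sc: space.strictly_convex
  shows "space.midpoint_convex {x \<in> X. displacement d \<phi> K x \<le> r}"
  unfolding space.midpoint_convex_def
proof (intro ballI allI impI CollectI conjI)
  fix x y p
  assume "x \<in> {x \<in> X. displacement d \<phi> K x \<le> r}" "y \<in> {x \<in> X. displacement d \<phi> K x \<le> r}"
    and p: "space.is_midpoint x y p"
  then have xy: "x \<in> X" "y \<in> X" and le: "displacement d \<phi> K x \<le> r" "displacement d \<phi> K y \<le> r"
    by auto
  show "p \<in> X"
    using p by (simp add: space.is_midpoint_def)
  then show "displacement d \<phi> K p \<le> r"
  proof (rule displacement_leI)
    fix k assume k: "k \<in> K"
    note kG = in_carrier[OF k]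
    \<comment> \<open>\<open>\<phi> k p\<close> is the midpoint of \<open>\<phi> k x\<close> and
      \<open>\<phi> k y\<close>, so \<open>k\<close> moves \<open>p\<close> by at most the mean of
      what it moves \<open>x\<close> and \<open>y\<close>.\<close>
    have "2 * d p (\<phi> k p) \<le> d x (\<phi> k x) + d y (\<phi> k y)"
      by (rule space.busemann_midpoints_dist[OF bnpc sc xy image_in_space[OF kG xy(1)]
            image_in_space[OF kG xy(2)] p image_midpoint[OF kG xy p]])
    then show "d p (\<phi> k p) \<le> r"
      using displacement_ge[OF xy(1) k] displacement_ge[OF xy(2) k] le by linarith
  qed
qed

end

end

section \<open>The set of minimal displacement\<close>

theorem lemma1p1:
  fixes G :: "('g, 'b) monoid_scheme" and T :: "'g topology" and K :: "'g set"
    and X :: "'x set" and d :: "'x \<Rightarrow> 'x \<Rightarrow> real" and \<phi> :: "'g \<Rightarrow> 'x \<Rightarrow> 'x"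
    and m :: real and M :: "'x set"
  assumes "locally_compact_group G T"
    and "compactin T K" and "\<one>\<^bsub>G\<^esub> \<in> K" and "generate G K = carrier G"
    and "Metric_space X d"
    and "Metric_space.geodesic_space X d"
    and "Metric_space.mcomplete X d"
    and "Metric_space.busemann_nonpositively_curved X d"
    and "Metric_space.uniformly_convex X d"
    and "continuous_isometric_action G T X d \<phi>"
    and "\<And>R. Metric_space.mbounded X d {x \<in> X. displacement d \<phi> K x \<le> R}"
  defines "m \<equiv> (INF x\<in>X. displacement d \<phi> K x)"
  defines "M \<equiv> {x \<in> X. displacement d \<phi> K x = m}"
  shows "M \<noteq> {} \<and> closedin (Metric_space.mtopology X d) M \<and>
         Metric_space.geodesically_convex X d M \<and> Metric_space.mbounded X d M"
proof -
  interpret continuous_isometric_action G T X d \<phi>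
    by fact
  let ?f = "displacement d \<phi> K"
  let ?C = "\<lambda>r. {x \<in> X. ?f x \<le> r}"
  have K: "compactin T K" "K \<noteq> {}"
    using assms(2,3) by auto
  have sc: space.strictly_convex
    using assms(9) by (simp add: space.uniformly_convex_def)
  note closed = closedin_displacement_sublevel[OF K]
  note mid = midpoint_convex_displacement_sublevel[OF K assms(8) sc]
  have "X \<noteq> {}"
    using assms(6) by (simp add: space.geodesic_space_def)
  \<comment> \<open>A real \<open>INF\<close> is meaningful only over a nonempty set of values
    bounded below.\<close>
  have bdd: "bdd_below (?f ` X)"
    using displacement_nonneg[OF K] by (rule bdd_belowI2)
  have m_le: "m \<le> ?f x" if "x \<in> X" for x
    unfolding m_def using bdd that by (rule cINF_lower)
  \<comment> \<open>As a sublevel set, \<open>M\<close> inherits closedness, convexity and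
    boundedness; only non-emptiness remains.\<close>
  then have M_eq: "M = ?C m"
    by (auto simp: M_def intro: antisym)
  have "(\<Inter>n. ?C (m + 1 / Suc n)) \<noteq> {}"
  \<comment> \<open>The first set is the sublevel set at \<open>m + 1\<close>, bounded by the growth
    hypothesis.\<close>
  proof (rule space.uniformly_convex_Inter_nonempty[OF assms(7,9) closed mid _ _ assms(11)])
    show "?C (m + 1 / Suc n) \<noteq> {}" for n
    proof -
      have "m < m + 1 / Suc n"
        by simp
      then obtain x where "x \<in> X" "?f x < m + 1 / Suc n"
        using cINF_less_iff[OF \<open>X \<noteq> {}\<close> bdd] unfolding m_def by blast
      then show ?thesis
        by force
    qed
    show "decseq (\<lambda>n. ?C (m + 1 / Suc n))"
    proof (intro decseq_SucI subsetI CollectI conjI; elim CollectE conjE)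
      fix n x assume "?f x \<le> m + 1 / Suc (Suc n)"
      moreover have "1 / real (Suc (Suc n)) \<le> 1 / real (Suc n)"
        by (simp add: frac_le)
      ultimately show "?f x \<le> m + 1 / Suc n"
        by linarith
    qed
  qed
  then obtain x where x: "x \<in> X" "\<And>n. ?f x \<le> m + 1 / Suc n"
    by auto
  have "(\<lambda>n. m + 1 / Suc n) \<longlonglongrightarrow> m + 0"
    using LIMSEQ_inverse_real_of_nat by (intro tendsto_intros) (auto simp: inverse_eq_divide)
  then have "?f x \<le> m"
    using x(2) LIMSEQ_le_const by fastforce
  then have "M \<noteq> {}"
    using x(1) M_eq by blast
  then show ?thesis
    unfolding M_eq
    using closed assms(11) space.geodesically_convex_if_midpoint_convex[OF closed mid] by blast
qed

end
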